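(* Let $k\ge 0$ and $n\ge 1$ be integers with $n\ge k$, and let $\mathsf{V}$ be the complex vector space with basis $v_0,v_1,\dots,v_n$. Then the representation $\pi_k:\mathsf{RB}_k(n+1)\to\operatorname{End}(\mathsf{V}^{\otimes k})$ of the rook-Brauer algebra on tensor space is faithful (that is, $\pi_k$ is injective).
   Context: A rook-Brauer $k$-diagram is a graph on two rows of $k$ vertices each (a top row and a bottom row, each numbered $1,\dots,k$ from left to right) in which each vertex is joined by an edge to at most one other vertex. The set of these diagrams is $\mathcal{RB}_k$. For $x\in\mathbb{C}$, the rook-Brauer algebra $\mathsf{RB}_k(x)$ is the $\mathbb{C}$-vector space with basis $\mathcal{RB}_k$ (with $\mathsf{RB}_0(x)=\mathbb{C}1$) and bilinear multiplication determined as follows. For diagrams $d_1,d_2$, place $d_1$ above $d_2$ and identify the bottom vertices of $d_1$ with the corresponding top vertices of $d_2$. Then $d_1d_2=x^{\kappa(d_1,d_2)}d_3$, where $\kappa(d_1,d_2)$ is the number of closed loops formed entirely in the middle row, and $d_3$ is the rook-Brauer diagram on the top row of $d_1$ and the bottom row of $d_2$ in which two vertices are joined by an edge if and only if they lie in the same connected component of the stacked graph. (Components contained in the middle row that are not closed loops are discarded with factor $1$.) The identity is the diagram joining the $i$th top vertex to the $i$th bottom vertex for every $i$. The representation $\pi_k:\mathsf{RB}_k(n+1)\to\operatorname{End}(\mathsf{V}^{\otimes k})$ is the linear map given on diagrams by $$\pi_k(d)(v_{i_1}\otimes\cdots\otimes v_{i_k})=\sum_{j_1,\dots,j_k\in\{0,\dots,n\}}(d)_{i_1,\dots,i_k}^{j_1,\dots,j_k}\;v_{j_1}\otimes\cdots\otimes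 v_{j_k}.$$ Here one labels the bottom vertices of $d$ from left to right by $i_1,\dots,i_k$ and the top vertices by $j_1,\dots,j_k$, and $(d)_{i_1,\dots,i_k}^{j_1,\dots,j_k}$ is the product over all connected components of $d$ of the following weights: an isolated vertex labeled $a$ has weight $\delta_{a,0}$, and an edge joining vertices labeled $a$ and $b$ has weight $\delta_{a,b}$. *)

theory Defs
  imports Complex_Main "HOL-Algebra.Module" "HOL-Library.FuncSet"
begin

section \<open>Rook-Brauer diagrams\<close>

datatype row = Top | Bottom

type_synonym vertex = "row \<times> nat"

text \<open>A diagram is given by its set of edges, an edge being the two-element set of its endpoints.\<close>

type_synonym diagram = "vertex set set"

definition vertices :: "nat \<Rightarrow> vertex set" where
  "vertices k = UNIV \<times> {1..k}"

definition rb_diagrams :: "nat \<Rightarrow> diagram set" where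
  "rb_diagrams k =
     {d. (\<forall>e\<in>d. e \<subseteq> vertices k \<and> card e = 2) \<and>
         (\<forall>u v w. {u, v} \<in> d \<and> {u, w} \<in> d \<longrightarrow> v = w)}"

definition id_diagram :: "nat \<Rightarrow> diagram" where
  "id_diagram k = (\<lambda>i. {(Top, i), (Bottom, i)}) ` {1..k}"

section \<open>Stacking diagrams\<close>

datatype level = Upper | Middle | Lower

type_synonym stack_vertex = "level \<times> nat"

fun upper_emb :: "vertex \<Rightarrow> stack_vertex" where
  "upper_emb (Top, i) = (Upper, i)"
| "upper_emb (Bottom, i) = (Middle, i)"

fun lower_emb :: "vertex \<Rightarrow> stack_vertex" where
  "lower_emb (Top, i) = (Middle, i)"
| "lower_emb (Bottom, i) = (Lower, i)"

fun outer_emb :: "vertex \<Rightarrow> stack_vertex" where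
  "outer_emb (Top, i) = (Upper, i)"
| "outer_emb (Bottom, i) = (Lower, i)"

definition upper_edges :: "diagram \<Rightarrow> stack_vertex set set" where
  "upper_edges d = (\<lambda>e. upper_emb ` e) ` d"

definition lower_edges :: "diagram \<Rightarrow> stack_vertex set set" where
  "lower_edges d = (\<lambda>e. lower_emb ` e) ` d"

definition stack_connected :: "diagram \<Rightarrow> diagram \<Rightarrow> (stack_vertex \<times> stack_vertex) set" where
  "stack_connected d1 d2 = {(u, v). {u, v} \<in> upper_edges d1 \<union> lower_edges d2}\<^sup>*"

text \<open>
  The stacked graph is a multigraph: a bottom edge of \<open>d1\<close> and a top edge of \<open>d2\<close> may join the
  same two middle vertices, and then they form a closed loop. Every vertex lies on at most one edge
  of \<open>d1\<close> and at most one edge of \<open>d2\<close>, so each component is a path or a cycle, and it is a cycle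
  iff each of its vertices has degree two, i.e. lies on an edge of \<open>d1\<close> and on an edge of \<open>d2\<close>.
  Such a component is automatically contained in the middle row.
\<close>

definition closed_loops :: "nat \<Rightarrow> diagram \<Rightarrow> diagram \<Rightarrow> stack_vertex set set" where
  "closed_loops k d1 d2 =
     {C. \<exists>u \<in> {Middle} \<times> {1..k}. C = stack_connected d1 d2 `` {u} \<and>
           C \<subseteq> {Middle} \<times> {1..k} \<and>
           (\<forall>w\<in>C. w \<in> \<Union> (upper_edges d1) \<and> w \<in> \<Union> (lower_edges d2))}"

definition loop_number :: "nat \<Rightarrow> diagram \<Rightarrow> diagram \<Rightarrow> nat" where
  "loop_number k d1 d2 = card (closed_loops k d1 d2)"

definition diagram_comp :: "nat \<Rightarrow> diagram \<Rightarrow> diagram \<Rightarrow> diagram" where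
  "diagram_comp k d1 d2 =
     {{u, v} | u v. u \<in> vertices k \<and> v \<in> vertices k \<and> u \<noteq> v \<and>
                    (outer_emb u, outer_emb v) \<in> stack_connected d1 d2}"

section \<open>The rook-Brauer algebra\<close>

text \<open>
  Elements are coefficient functions on diagrams, vanishing off \<^term>\<open>rb_diagrams k\<close>;
  \<^term>\<open>rb_basis d\<close> is the diagram \<open>d\<close> as an element of the algebra.
\<close>

definition rb_basis :: "diagram \<Rightarrow> diagram \<Rightarrow> complex" where
  "rb_basis d = (\<lambda>d'. if d' = d then 1 else 0)"

definition rb_algebra :: "nat \<Rightarrow> complex \<Rightarrow> (complex, diagram \<Rightarrow> complex) module" where
  "rb_algebra k x =
     \<lparr>carrier = {a. \<forall>d. d \<notin> rb_diagrams k \<longrightarrow> a d = 0},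
      monoid.mult = (\<lambda>a b d. \<Sum>d1\<in>rb_diagrams k. \<Sum>d2\<in>rb_diagrams k.
         a d1 * b d2 * x ^ loop_number k d1 d2 * rb_basis (diagram_comp k d1 d2) d),
      one = rb_basis (id_diagram k),
      zero = (\<lambda>d. 0),
      add = (\<lambda>a b d. a d + b d),
      smult = (\<lambda>c a d. c * a d)\<rparr>"

section \<open>Tensor space\<close>

text \<open>
  With \<open>V\<close> the space with basis \<open>v\<^sub>0, \<dots>, v\<^sub>n\<close>, an element of the \<open>k\<close>-th tensor power of \<open>V\<close> is given
  by its coordinates with respect to the basis of the tensors \<open>v\<^bsub>i 1\<^esub> \<otimes> \<dots> \<otimes> v\<^bsub>i k\<^esub>\<close>, which are
  indexed by the functions \<open>i\<close> from \<open>{1..k}\<close> to \<open>{0..n}\<close>. For \<open>k = 0\<close> there is exactly one index.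
\<close>

type_synonym multi_index = "nat \<Rightarrow> nat"
type_synonym tensor = "multi_index \<Rightarrow> complex"

definition multi_indices :: "nat \<Rightarrow> nat \<Rightarrow> multi_index set" where
  "multi_indices n k = {1..k} \<rightarrow>\<^sub>E {0..n}"

definition tensor_space :: "nat \<Rightarrow> nat \<Rightarrow> tensor set" where
  "tensor_space n k = {t. \<forall>i. i \<notin> multi_indices n k \<longrightarrow> t i = 0}"

definition tensor_basis :: "multi_index \<Rightarrow> tensor" where
  "tensor_basis i = (\<lambda>j. if j = i then 1 else 0)"

text \<open>Endomorphisms are taken to be \<^const>\<open>undefined\<close> off the tensor space.\<close>

definition tensor_End :: "nat \<Rightarrow> nat \<Rightarrow> (tensor \<Rightarrow> tensor) set" where
  "tensor_End n k =
     {f \<in> tensor_space n k \<rightarrow>\<^sub>E tensor_space n k.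
        (\<forall>s\<in>tensor_space n k. \<forall>t\<in>tensor_space n k. f (\<lambda>i. s i + t i) = (\<lambda>i. f s i + f t i)) \<and>
        (\<forall>c. \<forall>t\<in>tensor_space n k. f (\<lambda>i. c * t i) = (\<lambda>i. c * f t i))}"

section \<open>The representation on tensor space\<close>

fun vertex_label :: "multi_index \<Rightarrow> multi_index \<Rightarrow> vertex \<Rightarrow> nat" where
  "vertex_label i j (Top, p) = j p"
| "vertex_label i j (Bottom, p) = i p"

text \<open>
  The components of a diagram are its isolated vertices and its edges;
  \<open>weight k d i j\<close> is the matrix entry with bottom labels \<open>i\<close> and top labels \<open>j\<close>.
\<close>

definition weight :: "nat \<Rightarrow> diagram \<Rightarrow> multi_index \<Rightarrow> multi_index \<Rightarrow> complex" where
  "weight k d i j =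
     (\<Prod>u\<in>vertices k - \<Union> d. if vertex_label i j u = 0 then 1 else 0) *
     (\<Prod>e\<in>d. if \<forall>u\<in>e. \<forall>v\<in>e. vertex_label i j u = vertex_label i j v then 1 else 0)"

definition diagram_action :: "nat \<Rightarrow> nat \<Rightarrow> diagram \<Rightarrow> tensor \<Rightarrow> tensor" where
  "diagram_action n k d =
     (\<lambda>t\<in>tensor_space n k. \<lambda>l. \<Sum>i\<in>multi_indices n k.
        t i * (\<Sum>j\<in>multi_indices n k. weight k d i j * tensor_basis j l))"

definition tensor_rep :: "nat \<Rightarrow> nat \<Rightarrow> (diagram \<Rightarrow> complex) \<Rightarrow> tensor \<Rightarrow> tensor" where
  "tensor_rep n k a =
     (\<lambda>t\<in>tensor_space n k. \<lambda>l. \<Sum>d\<in>rb_diagrams k. a d * diagram_action n k d t l)"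

lemma finite_rb_diagrams: "finite (rb_diagrams k)"
proof (rule finite_subset)
  show "rb_diagrams k \<subseteq> Pow (Pow (vertices k))" by (auto simp: rb_diagrams_def)
  have "finite (UNIV :: row set)"
    by (rule finite_subset[of _ "{Top, Bottom}"]) (auto intro: row.exhaust)
  thus "finite (Pow (Pow (vertices k)))" by (simp add: vertices_def)
qed

lemma finite_multi_indices: "finite (multi_indices n k)"
  by (simp add: multi_indices_def finite_PiE)

lemma tensor_basis_in_space: "i \<in> multi_indices n k \<Longrightarrow> tensor_basis i \<in> tensor_space n k"
  by (auto simp: tensor_basis_def tensor_space_def)

lemma rb_basis_in_carrier: "d \<in> rb_diagrams k \<Longrightarrow> rb_basis d \<in> carrier (rb_algebra k x)"
  by (auto simp: rb_basis_def rb_algebra_def)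

lemma tensor_rep_basis:
  assumes "d \<in> rb_diagrams k" "i \<in> multi_indices n k"
  shows "tensor_rep n k (rb_basis d) (tensor_basis i) =
    (\<lambda>l. \<Sum>j\<in>multi_indices n k. weight k d i j * tensor_basis j l)"
proof -
  have *: "(if b then 1 else 0) * y = (if b then y else 0)" for b and y :: complex by simp
  have A: "diagram_action n k d (tensor_basis i) =
    (\<lambda>l. \<Sum>j\<in>multi_indices n k. weight k d i j * tensor_basis j l)"
    unfolding diagram_action_def
    by (simp add: tensor_basis_in_space assms finite_multi_indices)
       (simp add: tensor_basis_def[of i] * assms finite_multi_indices)
  show ?thesis
    unfolding tensor_rep_def rb_basis_def
    by (simp add: tensor_basis_in_space assms finite_rb_diagrams * A)
qed

lemma tensor_rep_in_End: "tensor_rep n k a \<in> tensor_End n k"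
proof -
  have V: "diagram_action n k d t l = 0" 
    if "t \<in> tensor_space n k" "l \<notin> multi_indices n k" for d t l
    using that by (auto simp: diagram_action_def tensor_basis_def intro!: sum.neutral)
  have add: "(\<lambda>i. s i + t i) \<in> tensor_space n k"
    if "s \<in> tensor_space n k" "t \<in> tensor_space n k" for s t
    using that by (simp add: tensor_space_def)
  have scale: "(\<lambda>i. c * t i) \<in> tensor_space n k" if "t \<in> tensor_space n k" for c t
    using that by (simp add: tensor_space_def)
  have mem: "tensor_rep n k a t \<in> tensor_space n k" if "t \<in> tensor_space n k" for t
    using that V by (simp add: tensor_rep_def tensor_space_def)
  show ?thesis
    unfolding tensor_End_def
    using mem add scale
    by (auto simp: tensor_rep_def diagram_action_def extensional_def PiE_def
        distrib_left distrib_right sum.distrib sum_distrib_left mult.assoc mult.left_commute)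
qed

lemma tensor_rep_add:
  "tensor_rep n k (a \<oplus>\<^bsub>rb_algebra k x\<^esub> b) =
   (\<lambda>t\<in>tensor_space n k. \<lambda>l. tensor_rep n k a t l + tensor_rep n k b t l)"
  by (auto simp: tensor_rep_def rb_algebra_def distrib_right sum.distrib)

lemma tensor_rep_smult:
  "tensor_rep n k (c \<odot>\<^bsub>rb_algebra k x\<^esub> a) =
   (\<lambda>t\<in>tensor_space n k. \<lambda>l. c * tensor_rep n k a t l)"
  by (auto simp: tensor_rep_def rb_algebra_def sum_distrib_left mult.assoc)

end

theory Submission
  imports Defs
begin

text \<open>
  Label each edge of a diagram \<open>d\<close> by its own number in \<open>{1..n}\<close> and the isolated vertices
  by \<open>0\<close>; this is possible because \<open>d\<close> has at most \<open>k \<le> n\<close> edges. The matrix entry of a diagram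
  \<open>d'\<close> at this labelling is \<open>1\<close> if \<open>d \<subseteq> d'\<close> and \<open>0\<close> otherwise. So the matrices of the diagrams
  are unitriangular with respect to inclusion of edge sets, hence linearly independent.
\<close>

lemma finite_vertices: "finite (vertices k)"
  and card_vertices: "card (vertices k) = 2 * k"
proof -
  have UNIV_row: "(UNIV :: row set) = {Top, Bottom}"
    by (auto intro: row.exhaust)
  show "finite (vertices k)" "card (vertices k) = 2 * k"
    by (simp_all add: vertices_def UNIV_row card_cartesian_product)
qed

lemma rb_diagrams_edge:
  assumes "d \<in> rb_diagrams k" "e \<in> d"
  shows "e \<subseteq> vertices k" "card e = 2"
  using assms unfolding rb_diagrams_def by blast+

lemma rb_diagrams_edge_obtain:
  assumes "d \<in> rb_diagrams k" "e \<in> d" "u \<in> e"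
  obtains v where "e = {u, v}" "v \<noteq> u"
  using rb_diagrams_edge(2)[OF assms(1,2)] assms(3) by (auto simp: card_2_iff)

text \<open>Turns the condition that a vertex has at most one partner into disjointness of distinct
  edges.\<close>

lemma rb_diagrams_edge_unique:
  assumes "d \<in> rb_diagrams k" "e \<in> d" "e' \<in> d" "u \<in> e" "u \<in> e'"
  shows "e = e'"
proof -
  obtain v where v: "e = {u, v}" using rb_diagrams_edge_obtain assms by metis
  obtain w where w: "e' = {u, w}" using rb_diagrams_edge_obtain assms by metis
  have "v = w" using assms(1-3) unfolding v w rb_diagrams_def by blast
  then show ?thesis by (simp add: v w)
qed

lemma finite_rb_diagram: "d \<in> rb_diagrams k \<Longrightarrow> finite d"
  using rb_diagrams_edge(1) finite_vertices
  by (intro finite_subset[of d "Pow (vertices k)"]) blast+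

text \<open>The edges are pairwise disjoint pairs among the \<open>2 * k\<close> vertices.\<close>

lemma card_rb_diagram_le:
  assumes d: "d \<in> rb_diagrams k"
  shows "card d \<le> k"
proof -
  have sub: "\<Union> d \<subseteq> vertices k" using rb_diagrams_edge(1)[OF d] by blast
  have "2 * card d = card (\<Union> d)"
  proof (rule card_partition)
    show "finite d" by (rule finite_rb_diagram[OF d])
    show "finite (\<Union> d)" using sub finite_vertices by (rule finite_subset)
    show "card e = 2" if "e \<in> d" for e using rb_diagrams_edge(2)[OF d that] .
    show "e \<inter> e' = {}" if "e \<in> d" "e' \<in> d" "e \<noteq> e'" for e e'
      using rb_diagrams_edge_unique[OF d] that by blast
  qed
  also have "\<dots> \<le> 2 * k" using card_mono[OF finite_vertices sub] by (simp add: card_vertices)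
  finally show ?thesis by simp
qed

text \<open>A finite product of factors 0 and 1 is the indicator of the conjunction of their
  conditions, so weights can be compared by logic alone.\<close>

lemma weight_eq_indicator:
  assumes "d \<in> rb_diagrams k"
  shows "weight k d i j =
    (if (\<forall>u\<in>vertices k - \<Union> d. vertex_label i j u = 0) \<and>
        (\<forall>e\<in>d. \<forall>u\<in>e. \<forall>v\<in>e. vertex_label i j u = vertex_label i j v) then 1 else 0)"
proof -
  have prod_indicator: "(\<Prod>x\<in>A. if P x then 1 else 0) = (if \<forall>x\<in>A. P x then 1 else (0 :: complex))"
    if "finite A" for A :: "'a set" and P
    using that by induction auto
  show ?thesis
    unfolding weight_def prod_indicator[OF finite_rb_diagram[OF assms]]
      prod_indicator[OF finite_Diff[OF finite_vertices]]
    by (simp only: if_conn mult_1_left mult_zero_left if_distrib[of "\<lambda>x. x * _"])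
qed

lemma separating_labels:
  assumes d: "d \<in> rb_diagrams k" and "k \<le> n"
  obtains i j where "i \<in> multi_indices n k" "j \<in> multi_indices n k"
    "\<And>d'. d' \<in> rb_diagrams k \<Longrightarrow> weight k d' i j = (if d \<subseteq> d' then 1 else 0)"
proof -
  obtain g where g: "bij_betw g d {1..card d}"
    using finite_same_card_bij[OF finite_rb_diagram[OF d], of "{1..card d}"] by auto
  \<comment> \<open>The \<open>THE\<close> is meaningful because distinct edges are disjoint. Edge
    numbers start at 1, which keeps 0 free for the isolated vertices.\<close>
  define lab where "lab u = (if u \<in> \<Union> d then g (THE e. e \<in> d \<and> u \<in> e) else 0)" for u
  have lab_edge: "lab u = g e" if "e \<in> d" "u \<in> e" for e u
  proof -
    have "(THE e. e \<in> d \<and> u \<in> e) = e"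
      by (rule the_equality) (use that rb_diagrams_edge_unique[OF d] in metis)+
    moreover have "u \<in> \<Union> d" using that by blast
    ultimately show ?thesis by (simp add: lab_def)
  qed
  have g_range: "g e \<in> {1..card d}" if "e \<in> d" for e
    using g that by (auto simp: bij_betw_def)
  have lab_zero: "lab u = 0 \<longleftrightarrow> u \<notin> \<Union> d" for u
  proof
    show "u \<notin> \<Union> d" if "lab u = 0"
    proof
      assume "u \<in> \<Union> d"
      then obtain e where "e \<in> d" "u \<in> e" by blast
      then show False using that lab_edge[of e u] g_range[of e] by simp
    qed
  qed (simp add: lab_def)
  have lab_le: "lab u \<le> n" for u
  proof (cases "u \<in> \<Union> d")
    case True
    then obtain e where "e \<in> d" "u \<in> e" by blast
    then show ?thesis
      using lab_edge g_range[of e] card_rb_diagram_le[OF d] \<open>k \<le> n\<close> by simp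
  next
    case False
    then show ?thesis by (simp add: lab_def)
  qed
  \<comment> \<open>Multi-indices are extensional on \<open>{1..k}\<close>, hence the restriction;
    the labels of \<open>i\<close> and \<open>j\<close> are compared with \<open>lab\<close> only on
    \<open>vertices k\<close>.\<close>
  define i j where "i = (\<lambda>p\<in>{1..k}. lab (Bottom, p))" and "j = (\<lambda>p\<in>{1..k}. lab (Top, p))"
  have ij: "i \<in> multi_indices n k" "j \<in> multi_indices n k"
    by (auto simp: i_def j_def multi_indices_def lab_le)
  have label: "vertex_label i j u = lab u" if "u \<in> vertices k" for u
    using that by (cases "(i, j, u)" rule: vertex_label.cases) (auto simp: i_def j_def vertices_def)
  have "weight k d' i j = (if d \<subseteq> d' then 1 else 0)" if d': "d' \<in> rb_diagrams k" for d'
  proof -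
    have "(\<forall>u\<in>vertices k - \<Union> d'. vertex_label i j u = 0) \<and>
          (\<forall>e\<in>d'. \<forall>u\<in>e. \<forall>v\<in>e. vertex_label i j u = vertex_label i j v) \<longleftrightarrow>
          (\<forall>u\<in>vertices k - \<Union> d'. lab u = 0) \<and> (\<forall>e\<in>d'. \<forall>u\<in>e. \<forall>v\<in>e. lab u = lab v)"
      by (intro arg_cong2[of _ _ _ _ "(\<and>)"] ball_cong refl)
         (use label rb_diagrams_edge(1)[OF d'] in \<open>auto simp: label subset_eq\<close>)
    also have "\<dots> \<longleftrightarrow> d \<subseteq> d'"
    proof
      assume consistent: "(\<forall>u\<in>vertices k - \<Union> d'. lab u = 0) \<and>
        (\<forall>e\<in>d'. \<forall>u\<in>e. \<forall>v\<in>e. lab u = lab v)"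
      show "d \<subseteq> d'"
      proof
        fix e assume e: "e \<in> d"
        obtain u where u: "u \<in> e"
          using rb_diagrams_edge(2)[OF d e] by (metis card.empty ex_in_conv zero_neq_numeral)
        \<comment> \<open>A vertex with nonzero label cannot be isolated in \<open>d'\<close>, so
          some edge \<open>e'\<close> of \<open>d'\<close> contains \<open>u\<close>. It remains to
          identify \<open>e'\<close> with \<open>e\<close>.\<close>
        have nz: "lab u \<noteq> 0" using e u lab_zero by blast
        have "u \<in> vertices k" using rb_diagrams_edge(1)[OF d e] u by (rule subsetD)
        then have "u \<in> \<Union> d'" using consistent nz by (meson DiffI)
        then obtain e' where e': "e' \<in> d'" "u \<in> e'" by (rule UnionE)
        \<comment> \<open>Since \<open>v\<close> shares the nonzero label of \<open>u\<close> and
          the numbering \<open>g\<close> is injective, \<open>v\<close> lies on \<open>e\<close>.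
          Thus \<open>e'\<close> is contained in \<open>e\<close>, and both have two
          elements.\<close>
        have "v \<in> e" if "v \<in> e'" for v
        proof -
          have eq: "lab v = lab u" using consistent e' that by metis
          then obtain f where f: "f \<in> d" "v \<in> f" using nz lab_zero by (metis UnionE)
          then have "g f = g e" using lab_edge e u eq by metis
          then have "f = e" using inj_onD[OF bij_betw_imp_inj_on[OF g]] f(1) e by simp
          then show ?thesis using f by simp
        qed
        then have "e' \<subseteq> e" by blast
        moreover have "finite e" "card e' = card e"
          using rb_diagrams_edge(2)[OF d e] rb_diagrams_edge(2)[OF d' e'(1)]
          by (auto intro: card_ge_0_finite)
        ultimately have "e' = e" by (metis card_subset_eq)
        then show "e \<in> d'" using e' by simp
      qed
    next
      assume sub: "d \<subseteq> d'"
      have "lab u = lab v" if e: "e \<in> d'" "u \<in> e" "v \<in> e" for e u v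
      proof (cases "e \<in> d")
        case True
        then show ?thesis using lab_edge e by metis
      next
        case False
        \<comment> \<open>An edge of \<open>d\<close> through an endpoint of \<open>e\<close> would
          also belong to \<open>d'\<close> and so coincide with \<open>e\<close>. Hence both
          endpoints are labelled 0.\<close>
        then have "u \<notin> \<Union> d" "v \<notin> \<Union> d"
          using rb_diagrams_edge_unique[OF d'] e sub by (metis UnionE subsetD)+
        then show ?thesis by (simp add: lab_def)
      qed
      then show "(\<forall>u\<in>vertices k - \<Union> d'. lab u = 0) \<and> (\<forall>e\<in>d'. \<forall>u\<in>e. \<forall>v\<in>e. lab u = lab v)"
        using sub lab_zero by (metis DiffD2 Union_mono subsetD)
    qed
    finally show ?thesis by (simp add: weight_eq_indicator[OF d'])
  qed
  with ij show thesis by (rule that)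
qed

text \<open>At the labelling that separates \<open>m\<close>, only supersets of \<open>m\<close>
  contribute. Taking \<open>m\<close> maximal in the support of \<open>c\<close> therefore isolates
  the single coefficient \<open>c m\<close>.\<close>

lemma weights_linearly_independent:
  fixes c :: "diagram \<Rightarrow> complex"
  assumes "k \<le> n" "d \<in> rb_diagrams k"
    and vanish: "\<And>i j. i \<in> multi_indices n k \<Longrightarrow> j \<in> multi_indices n k \<Longrightarrow>
      (\<Sum>d\<in>rb_diagrams k. c d * weight k d i j) = 0"
  shows "c d = 0"
proof (rule ccontr)
  let ?S = "{d \<in> rb_diagrams k. c d \<noteq> 0}"
  assume "c d \<noteq> 0"
  then have "finite ?S" "?S \<noteq> {}" using assms(2) finite_rb_diagrams by auto
  from finite_has_maximal[OF this] obtain m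
    where m: "m \<in> ?S" and max: "\<And>d'. d' \<in> ?S \<Longrightarrow> m \<subseteq> d' \<Longrightarrow> m = d'"
    by blast
  obtain i j where ij: "i \<in> multi_indices n k" "j \<in> multi_indices n k"
    and w: "\<And>d'. d' \<in> rb_diagrams k \<Longrightarrow> weight k d' i j = (if m \<subseteq> d' then 1 else 0)"
    using separating_labels[of m k n] m \<open>k \<le> n\<close> by blast
  have "(\<Sum>d\<in>rb_diagrams k. c d * weight k d i j) =
        (\<Sum>d\<in>rb_diagrams k. if d = m then c m else 0)"
    by (rule sum.cong) (use max w in auto)
  also have "\<dots> = c m" using m by (simp add: finite_rb_diagrams)
  finally show False using vanish[OF ij] m by simp
qed

text \<open>Both sums over multi-indices collapse on basis tensors, which reduces equality of
  operators to equations between weights.\<close>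

lemma tensor_rep_entry:
  assumes i: "i \<in> multi_indices n k" and j: "j \<in> multi_indices n k"
  shows "tensor_rep n k a (tensor_basis i) j = (\<Sum>d\<in>rb_diagrams k. a d * weight k d i j)"
proof -
  have mult_if: "(if b then 1 else 0) * y = (if b then y else 0)"
    "y * (if b then 1 else 0) = (if b then y else 0)" for b and y :: complex
    by simp_all
  have "diagram_action n k d (tensor_basis i) j = weight k d i j" for d
    using i j
    by (simp add: diagram_action_def tensor_basis_in_space)
       (simp add: tensor_basis_def mult_if finite_multi_indices)
  then show ?thesis by (simp add: tensor_rep_def tensor_basis_in_space i)
qed

theorem proposition3p15:
  fixes k n :: nat
  assumes "n \<ge> 1" and "n \<ge> k"
  shows "inj_on (tensor_rep n k) (carrier (rb_algebra k (of_nat (n + 1))))"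
proof (rule inj_onI)
  fix a b
  assume a: "a \<in> carrier (rb_algebra k (of_nat (n + 1)))"
    and b: "b \<in> carrier (rb_algebra k (of_nat (n + 1)))"
    and eq: "tensor_rep n k a = tensor_rep n k b"
  have "a d - b d = 0" if "d \<in> rb_diagrams k" for d
  proof (rule weights_linearly_independent[OF \<open>n \<ge> k\<close> that])
    fix i j assume "i \<in> multi_indices n k" "j \<in> multi_indices n k"
    then show "(\<Sum>d\<in>rb_diagrams k. (a d - b d) * weight k d i j) = 0"
      \<comment> \<open>Read from right to left, \<open>tensor_rep_entry\<close> turns the two sums
        into matrix entries of the images of \<open>a\<close> and \<open>b\<close>, which
        agree.\<close>
      using eq by (simp add: left_diff_distrib sum_subtractf flip: tensor_rep_entry)
  qed
  \<comment> \<open>Off \<open>rb_diagrams k\<close> both functions vanish by membership in the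
    carrier.\<close>
  with a b show "a = b" by (fastforce simp: rb_algebra_def)
qed

end
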